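(* Let $J\subset(0,\infty)$ be an interval and let $f:J\to(0,\infty)$ be a differentiable geometrically convex function. Then for any $s,t\in J$, $$\left(\frac{t}{s}\right)^{\frac{s f'(s)}{f(s)}}\le \frac{f(t)}{f(s)}\le \left(\frac{t}{s}\right)^{\frac{t f'(t)}{f(t)}}.$$
   Context: A function $f:J\to(0,\infty)$ on an interval $J\subset(0,\infty)$ is geometrically convex if $f(a^{1-\lambda}b^{\lambda})\le f(a)^{1-\lambda}f(b)^{\lambda}$ for all $a,b\in J$ and all $0\le\lambda\le1$. *)

theory Defs
  imports "HOL-Analysis.Analysis"
begin

(* Intended for J an interval contained in {0<..} and f positive on J; then all bases of powr are positive. *)
definition geometrically_convex_on :: "real set \<Rightarrow> (real \<Rightarrow> real) \<Rightarrow> bool" where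
  "geometrically_convex_on J f \<longleftrightarrow>
     (\<forall>a\<in>J. \<forall>b\<in>J. \<forall>l\<in>{0..1}.
        f (a powr (1 - l) * b powr l) \<le> f a powr (1 - l) * f b powr l)"

end

theory Submission
  imports Defs
begin

text \<open>Restricted to the geometric segment from \<open>s\<close> to \<open>t\<close>, the function \<open>ln \<circ> f\<close> lies below its
  chord, so its one-sided derivative at \<open>s\<close> is at most the slope \<open>ln (f t / f s)\<close> of the chord. This
  is the lower bound; the upper bound is the lower bound with \<open>s\<close> and \<open>t\<close> exchanged.\<close>

text \<open>Both exponents are nonnegative, so the mean is monotone in each base. Replacing both
  bases by \<open>min s t\<close>, or both by \<open>max s t\<close>, bounds it by these two points
  of \<open>J\<close>, because the exponents add up to 1.\<close>

lemma weighted_geometric_mean_in_interval: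
  fixes J :: "real set"
  assumes J: "is_interval J" "s \<in> J" "t \<in> J" and pos: "0 < s" "0 < t" and l: "0 \<le> l" "l \<le> 1"
  shows "s powr (1 - l) * t powr l \<in> J"
proof -
  have split: "x powr (1 - l) * x powr l = x" if "0 < x" for x :: real
    using that by (simp flip: powr_add)
  have "min s t powr (1 - l) * min s t powr l \<le> s powr (1 - l) * t powr l"
    using pos l by (intro mult_mono powr_mono2) auto
  moreover have "s powr (1 - l) * t powr l \<le> max s t powr (1 - l) * max s t powr l"
    using pos l by (intro mult_mono powr_mono2) auto
  moreover have "min s t \<in> J" "max s t \<in> J"
    using J by (auto simp: min_def max_def)
  ultimately show ?thesis
    using split[of "min s t"] split[of "max s t"] pos J(1) by (auto intro: mem_is_interval_1_I)
qed

text \<open>For \<open>l > 0\<close>, subtracting \<open>g 0\<close> from the chord inequality and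
  dividing by \<open>l\<close> bounds the difference quotient by \<open>g 1 - g 0\<close>; the bound
  survives the limit from the right.\<close>

lemma deriv_le_chord_slope:
  fixes g :: "real \<Rightarrow> real"
  assumes deriv: "(g has_real_derivative D) (at 0 within {0..1})"
    and chord: "\<And>l. 0 \<le> l \<Longrightarrow> l \<le> 1 \<Longrightarrow> g l \<le> (1 - l) * g 0 + l * g 1"
  shows "D \<le> g 1 - g 0"
proof (rule tendsto_upperbound)
  show "((\<lambda>l. (g l - g 0) / (l - 0)) \<longlongrightarrow> D) (at 0 within {0..1})"
    using deriv by (simp add: has_field_derivative_iff)
  have "(g l - g 0) / (l - 0) \<le> g 1 - g 0" if "l \<in> {0..1}" "l \<noteq> 0" for l
    using chord[of l] that by (simp add: field_simps)
  then show "\<forall>\<^sub>F l in at 0 within {0..1}. (g l - g 0) / (l - 0) \<le> g 1 - g 0"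
    by (auto simp: eventually_at_filter)
  show "at (0::real) within {0..1} \<noteq> bot"
    by (simp add: at_within_Icc_at_right)
qed

lemma geometrically_convex_on_lower_bound:
  fixes f :: "real \<Rightarrow> real"
  assumes J: "is_interval J" "J \<subseteq> {0<..}"
    and fpos: "\<And>x. x \<in> J \<Longrightarrow> f x > 0"
    and deriv: "(f has_real_derivative D) (at s within J)"
    and gc: "geometrically_convex_on J f"
    and st: "s \<in> J" "t \<in> J"
  shows "(t / s) powr (s * D / f s) \<le> f t / f s"
proof -
  have pos: "0 < s" "0 < t" "0 < f s" "0 < f t"
    using J(2) st fpos by auto
  define p where "p l = s powr (1 - l) * t powr l" for l
  have p01: "p 0 = s" "p 1 = t"
    using pos by (simp_all add: p_def)
  have pJ: "p l \<in> J" if "0 \<le> l" "l \<le> 1" for l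
    using weighted_geometric_mean_in_interval[OF J(1) st pos(1,2) that] by (simp add: p_def)
  \<comment> \<open>The path \<open>p\<close> is the exponential of an affine function of slope
    \<open>ln (t / s)\<close>, so its derivative at 0 is \<open>p 0\<close> times this
    slope.\<close>
  have "(p has_real_derivative s * ln (t / s)) (at 0 within {0..1})"
  proof -
    have "p = (\<lambda>l. exp ((1 - l) * ln s + l * ln t))"
      using pos by (simp add: p_def powr_def exp_add fun_eq_iff)
    then show ?thesis
      using pos by (auto intro!: derivative_eq_intros simp: ln_div algebra_simps)
  qed
  \<comment> \<open>The point \<open>s\<close> may be an endpoint of \<open>J\<close>, so the chain
    rule is applied with derivatives relative to the path, whose image stays in
    \<open>J\<close>.\<close>
  moreover have "(f has_real_derivative D) (at (p 0) within p ` {0..1})"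
    unfolding p01 using pJ by (intro DERIV_subset[OF deriv]) auto
  ultimately have "((\<lambda>l. f (p l)) has_real_derivative D * (s * ln (t / s))) (at 0 within {0..1})"
    using DERIV_image_chain[of f D p 0 "{0..1}"] by (simp add: o_def)
  then have "((\<lambda>l. ln (f (p l))) has_real_derivative D * (s * ln (t / s)) / f s) (at 0 within {0..1})"
    using pos by (auto intro!: derivative_eq_intros simp: p01)
  moreover have "ln (f (p l)) \<le> (1 - l) * ln (f (p 0)) + l * ln (f (p 1))" if "0 \<le> l" "l \<le> 1" for l
  proof -
    have "f (p l) \<le> f s powr (1 - l) * f t powr l"
      using gc st that by (auto simp: geometrically_convex_on_def p_def)
    \<comment> \<open>The logarithm turns the weighted geometric mean of \<open>f s\<close> and
      \<open>f t\<close> into the weighted arithmetic mean of their logarithms, which is the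
      chord.\<close>
    then have "ln (f (p l)) \<le> ln (f s powr (1 - l) * f t powr l)"
      using fpos[OF pJ[OF that]] by (intro ln_mono) auto
    then show ?thesis
      using pos by (simp add: ln_mult ln_powr p01)
  qed
  ultimately have "D * (s * ln (t / s)) / f s \<le> ln (f t) - ln (f s)"
    using deriv_le_chord_slope[of "\<lambda>l. ln (f (p l))"] by (simp add: p01)
  \<comment> \<open>The derivative is the exponent \<open>s * D / f s\<close> times
    \<open>ln (t / s)\<close>, hence the logarithm of the power sought.\<close>
  then have "ln ((t / s) powr (s * D / f s)) \<le> ln (f t / f s)"
    using pos by (simp add: ln_powr ln_div algebra_simps)
  then show ?thesis
    using pos by (subst (asm) ln_le_cancel_iff) auto
qed

theorem theorem2p8:
  fixes J :: "real set" and f f' :: "real \<Rightarrow> real" and s t :: real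
  assumes "is_interval J" and "J \<subseteq> {0<..}"
    and "\<And>x. x \<in> J \<Longrightarrow> f x > 0"
    and "\<And>x. x \<in> J \<Longrightarrow> (f has_real_derivative f' x) (at x within J)"
    and "geometrically_convex_on J f"
    and "s \<in> J" and "t \<in> J"
  shows "(t / s) powr (s * f' s / f s) \<le> f t / f s \<and>
         f t / f s \<le> (t / s) powr (t * f' t / f t)"
proof
  note lower = geometrically_convex_on_lower_bound[OF assms(1-3) _ assms(5)]
  show "(t / s) powr (s * f' s / f s) \<le> f t / f s"
    using lower assms(4,6,7) by blast
  have pos: "0 < s" "0 < t" "0 < f s" "0 < f t"
    using assms(2,3,6,7) by auto
  have "(s / t) powr (t * f' t / f t) \<le> f s / f t"
    using lower assms(4,6,7) by blast
  \<comment> \<open>Taking reciprocals reverses the inequality and turns the base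
    \<open>s / t\<close> into \<open>t / s\<close> with the exponent unchanged.\<close>
  then have "inverse (f s / f t) \<le> inverse ((s / t) powr (t * f' t / f t))"
    using pos by (intro le_imp_inverse_le) auto
  then show "f t / f s \<le> (t / s) powr (t * f' t / f t)"
    using pos by (simp add: powr_divide)
qed

end
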